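(* For every integer $k\ge2$, ${\sf HPC}(k)\equiv_{\rm sW}{\sf WF}$.
   Context: A hypergraph $H=(V,E)$ consists of a countable set of vertices $V=\{v_0,v_1,\dots\}$ and a countable sequence of edges $E=\{e_1,e_2,\dots\}$, each edge being a set (of any cardinality, possibly infinite) of vertices. A $k$-coloring of $H$ is a function $f:V\to k=\{0,\dots,k-1\}$; it is proper if every edge with at least two vertices contains two vertices of different colors. ${\sf HPC}(k)$ is the Weihrauch problem taking a hypergraph $H$ and outputting $1$ if $H$ has a proper $k$-coloring and $0$ otherwise. ${\sf WF}$ takes a tree (set of finite sequences of natural numbers closed under initial subsequences) and outputs $1$ if it has no infinite path and $0$ otherwise. $f\le_{\rm sW}g$ means there are computable functionals $\Phi,\Psi$ such that for every input $x$ of $f$, $\Phi(x)$ is an input of $g$ and for every solution $y$ of $g$ on $\Phi(x)$, $\Psi(y)$ is a solution of $f$ on $x$; $\equiv_{\rm sW}$ means reducibility both ways. *)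

theory Defs
  imports "HOL-Library.Nat_Bijection" "HOL-Library.Sublist"
begin

type_synonym baire = "nat \<Rightarrow> nat"

section \<open>Computable functionals on Baire space\<close>

text \<open>Kleene's partial recursive functions relative to an oracle, as a syntax of programs.\<close>

datatype oprog =
    Zero
  | Succ
  | Proj nat
  | Oracle
  | Comp oprog "oprog list"
  | PrimRec oprog oprog
  | Minim oprog

text \<open>\<open>oeval x e as r\<close>: program \<open>e\<close> with oracle \<open>x\<close> halts on the arguments \<open>as\<close> with result \<open>r\<close>.
  The recursion argument of \<^const>\<open>PrimRec\<close> and the search argument of \<^const>\<open>Minim\<close> come first.\<close>

inductive oeval :: "baire \<Rightarrow> oprog \<Rightarrow> nat list \<Rightarrow> nat \<Rightarrow> bool" for x :: baire where
  Zero: "oeval x Zero as 0"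
| Succ: "oeval x Succ [n] (Suc n)"
| Proj: "i < length as \<Longrightarrow> oeval x (Proj i) as (as ! i)"
| Oracle: "oeval x Oracle [n] (x n)"
| Comp: "list_all2 (\<lambda>g b. oeval x g as b) gs bs \<Longrightarrow> oeval x f bs r
    \<Longrightarrow> oeval x (Comp f gs) as r"
| PrimRec_0: "oeval x f as r \<Longrightarrow> oeval x (PrimRec f g) (0 # as) r"
| PrimRec_Suc: "oeval x (PrimRec f g) (n # as) q \<Longrightarrow> oeval x g (n # q # as) r
    \<Longrightarrow> oeval x (PrimRec f g) (Suc n # as) r"
| Minim: "oeval x f (n # as) 0 \<Longrightarrow> \<forall>m<n. \<exists>q>0. oeval x f (m # as) q
    \<Longrightarrow> oeval x (Minim f) as n"

text \<open>A partial functional is computable if a single program computes, for every \<open>x\<close> in its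
  domain, the entries of its value from oracle \<open>x\<close>.  As usual in Weihrauch theory, the domain
  need not be the largest possible one.\<close>

definition computable_functional :: "(baire \<Rightarrow> baire option) \<Rightarrow> bool" where
  "computable_functional \<Phi> \<longleftrightarrow>
     (\<exists>e. \<forall>x y. \<Phi> x = Some y \<longrightarrow> (\<forall>n. oeval x e [n] (y n)))"

section \<open>Problems and strong Weihrauch reducibility\<close>

record problem =
  inputs :: "baire set"
  solutions :: "baire \<Rightarrow> baire set"

definition sW_reducible :: "problem \<Rightarrow> problem \<Rightarrow> bool" (infix "\<le>\<^sub>s\<^sub>W" 50) where
  "f \<le>\<^sub>s\<^sub>W g \<longleftrightarrow>
     (\<exists>\<Phi> \<Psi>. computable_functional \<Phi> \<and> computable_functional \<Psi> \<and>
        (\<forall>x \<in> inputs f. \<exists>x'. \<Phi> x = Some x' \<and> x' \<in> inputs g \<and>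
           (\<forall>y \<in> solutions g x'. \<exists>y'. \<Psi> y = Some y' \<and> y' \<in> solutions f x)))"

definition sW_equivalent :: "problem \<Rightarrow> problem \<Rightarrow> bool" (infix "\<equiv>\<^sub>s\<^sub>W" 50) where
  "f \<equiv>\<^sub>s\<^sub>W g \<longleftrightarrow> f \<le>\<^sub>s\<^sub>W g \<and> g \<le>\<^sub>s\<^sub>W f"

text \<open>The problem of computing \<open>F a\<close> from a name of \<open>a\<close>, where \<open>\<delta> p a\<close> says that \<open>p\<close> is a name
  of \<open>a\<close>.  A sequence \<open>q\<close> is a name of the natural number \<open>q 0\<close>.\<close>

definition number_problem :: "(baire \<Rightarrow> 'a \<Rightarrow> bool) \<Rightarrow> ('a \<Rightarrow> nat) \<Rightarrow> problem" where
  "number_problem \<delta> F =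
     \<lparr>inputs = {p. \<exists>a. \<delta> p a}, solutions = (\<lambda>p. {q. \<exists>a. \<delta> p a \<and> q 0 = F a})\<rparr>"

section \<open>Hypergraph colorings\<close>

text \<open>The sequence of edges is \<open>edge H i\<close> for \<open>i \<in> edge_ixs H\<close>, where \<open>edge_ixs H\<close> is an initial
  segment of the natural numbers (all of them, or finitely many).  The values of \<open>edge H\<close> at
  other indices are irrelevant.\<close>

record hypergraph =
  verts :: "nat set"
  edge_ixs :: "nat set"
  edge :: "nat \<Rightarrow> nat set"

definition is_hypergraph :: "hypergraph \<Rightarrow> bool" where
  "is_hypergraph H \<longleftrightarrow>
     (\<forall>i \<in> edge_ixs H. \<forall>j < i. j \<in> edge_ixs H) \<and> (\<forall>i \<in> edge_ixs H. edge H i \<subseteq> verts H)"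

definition coloring :: "nat \<Rightarrow> hypergraph \<Rightarrow> (nat \<Rightarrow> nat) \<Rightarrow> bool" where
  "coloring k H f \<longleftrightarrow> (\<forall>v \<in> verts H. f v < k)"

definition proper :: "hypergraph \<Rightarrow> (nat \<Rightarrow> nat) \<Rightarrow> bool" where
  "proper H f \<longleftrightarrow>
     (\<forall>i \<in> edge_ixs H. (\<exists>u \<in> edge H i. \<exists>v \<in> edge H i. u \<noteq> v)
        \<longrightarrow> (\<exists>u \<in> edge H i. \<exists>v \<in> edge H i. f u \<noteq> f v))"

text \<open>A name of a hypergraph consists of the characteristic functions of its vertex set, of the
  index set of its edges, and of each of its edges.\<close>

definition hypergraph_name :: "baire \<Rightarrow> hypergraph \<Rightarrow> bool" where
  "hypergraph_name p H \<longleftrightarrow> is_hypergraph H \<and>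
     (\<forall>v. p (prod_encode (0, v)) = of_bool (v \<in> verts H)) \<and>
     (\<forall>i. p (prod_encode (1, i)) = of_bool (i \<in> edge_ixs H)) \<and>
     (\<forall>i \<in> edge_ixs H. \<forall>v. p (prod_encode (i + 2, v)) = of_bool (v \<in> edge H i))"

definition HPC :: "nat \<Rightarrow> problem" where
  "HPC k = number_problem hypergraph_name
     (\<lambda>H. if \<exists>f. coloring k H f \<and> proper H f then 1 else 0)"

section \<open>Well-founded trees\<close>

definition is_tree :: "nat list set \<Rightarrow> bool" where
  "is_tree T \<longleftrightarrow> (\<forall>\<sigma> \<in> T. \<forall>\<tau>. prefix \<tau> \<sigma> \<longrightarrow> \<tau> \<in> T)"

definition infinite_path :: "nat list set \<Rightarrow> (nat \<Rightarrow> nat) \<Rightarrow> bool" where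
  "infinite_path T g \<longleftrightarrow> (\<forall>n. map g [0..<n] \<in> T)"

definition tree_name :: "baire \<Rightarrow> nat list set \<Rightarrow> bool" where
  "tree_name p T \<longleftrightarrow> is_tree T \<and> (\<forall>\<sigma>. p (list_encode \<sigma>) = of_bool (\<sigma> \<in> T))"

definition WF :: problem where
  "WF = number_problem tree_name (\<lambda>T. if \<exists>g. infinite_path T g then 0 else 1)"

end

theory Submission
  imports Defs
begin

text \<open>Both reductions turn "has an infinite path" into "has a proper coloring", so they flip the
  answer.  A coloring with certificates, for each edge, of its properness is an infinite path
  through a computable tree.  Conversely, a tree has an infinite path iff some set of nodes
  contains the root and, with every node, one of its children in the tree.  Since edges may be
  infinite, these conditions are clauses of propositional logic, and such clauses are
  expressed by a 2-coloring in the style of not-all-equal satisfiability; additional vertices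
  that are joined to everything use up the other colors.\<close>

section \<open>Functions with total programs\<close>

text \<open>Environments are functions, so that the extension of an environment by a bound variable
  becomes the shift \<open>\<lambda>i. e (Suc i)\<close>, which disappears by \<open>\<beta>\<close>-reduction when the closure rules
  below are applied as introduction rules.\<close>

definition rec_fun :: "nat \<Rightarrow> (baire \<Rightarrow> (nat \<Rightarrow> nat) \<Rightarrow> nat) \<Rightarrow> bool" where
  "rec_fun n F \<longleftrightarrow> (\<exists>p. \<forall>x e. oeval x p (map e [0..<n]) (F x e))"

definition rec_pred :: "nat \<Rightarrow> (baire \<Rightarrow> (nat \<Rightarrow> nat) \<Rightarrow> bool) \<Rightarrow> bool" where
  "rec_pred n P \<longleftrightarrow> rec_fun n (\<lambda>x e. of_bool (P x e))"

lemma computable_functional_total: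
  assumes "rec_fun 1 (\<lambda>x e. F x (e 0))"
  shows "computable_functional (\<lambda>x. Some (F x))"
proof -
  obtain p where "\<And>x e. oeval x p (map e [0..<1]) (F x (e 0))"
    using assms unfolding rec_fun_def by blast
  from this[where e = "\<lambda>_. n" for n] show ?thesis
    unfolding computable_functional_def by (auto intro!: exI[of _ p])
qed

lemma rec_fun_proj: "i < n \<Longrightarrow> rec_fun n (\<lambda>x e. e i)"
  unfolding rec_fun_def
  by (intro exI[of _ "Proj i"] allI) (metis oeval.Proj add_0 diff_zero length_map length_upt nth_map nth_upt)

lemma rec_fun_Suc:
  assumes "rec_fun n A"
  shows "rec_fun n (\<lambda>x e. Suc (A x e))"
proof -
  obtain a where "\<And>x e. oeval x a (map e [0..<n]) (A x e)"
    using assms unfolding rec_fun_def by blast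
  then show ?thesis
    unfolding rec_fun_def
    by (intro exI[of _ "Comp Succ [a]"] allI oeval.Comp[where bs = "[A x e]" for x e])
      (auto intro: oeval.Succ)
qed

lemma rec_fun_oracle:
  assumes "rec_fun n A"
  shows "rec_fun n (\<lambda>x e. x (A x e))"
proof -
  obtain a where "\<And>x e. oeval x a (map e [0..<n]) (A x e)"
    using assms unfolding rec_fun_def by blast
  then show ?thesis
    unfolding rec_fun_def
    by (intro exI[of _ "Comp Oracle [a]"] allI oeval.Comp[where bs = "[A x e]" for x e])
      (auto intro: oeval.Oracle)
qed

lemma rec_fun_const: "rec_fun n (\<lambda>x e. c)"
proof (induction c)
  case 0
  show ?case unfolding rec_fun_def by (blast intro: oeval.Zero)
qed (rule rec_fun_Suc)

lemma rec_fun_rec_nat: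
  assumes "rec_fun n F" and "rec_fun (Suc (Suc n)) (\<lambda>x e. G x (e 0) (e (Suc 0)) (\<lambda>i. e (Suc (Suc i))))"
    and "rec_fun n A"
  shows "rec_fun n (\<lambda>x e. rec_nat (F x e) (\<lambda>m q. G x m q e) (A x e))"
proof -
  obtain f where f: "\<And>x e. oeval x f (map e [0..<n]) (F x e)"
    using assms(1) unfolding rec_fun_def by blast
  obtain g where g: "\<And>x e. oeval x g (map e [0..<Suc (Suc n)])
      (G x (e 0) (e (Suc 0)) (\<lambda>i. e (Suc (Suc i))))"
    using assms(2) unfolding rec_fun_def by blast
  obtain a where a: "\<And>x e. oeval x a (map e [0..<n]) (A x e)"
    using assms(3) unfolding rec_fun_def by blast
  \<comment> \<open>\<open>g\<close> is known only on argument lists cut from an environment;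
    \<open>case_nat\<close> puts \<open>m\<close> and \<open>q\<close> in front of
    \<open>e\<close>.\<close>
  have g': "oeval x g (m # q # map e [0..<n]) (G x m q e)" for x m q e
    using g[of x "case_nat m (case_nat q e)"] by (simp add: map_upt_Suc del: upt_Suc)
  have "oeval x (PrimRec f g) (m # map e [0..<n]) (rec_nat (F x e) (\<lambda>m q. G x m q e) m)" for x e m
    by (induction m) (auto intro: oeval.PrimRec_0 oeval.PrimRec_Suc f g')
  moreover have "list_all2 (\<lambda>g b. oeval x g (map e [0..<n]) b) (a # map Proj [0..<n])
      (A x e # map e [0..<n])" for x e
    using oeval.Proj[where as = "map e [0..<n]"] by (fastforce simp: list_all2_conv_all_nth a)
  ultimately show ?thesis
    unfolding rec_fun_def
    by (intro exI[of _ "Comp (PrimRec f g) (a # map Proj [0..<n])"] allI) (rule oeval.Comp)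
qed

text \<open>A sum puts its body under one more variable, where \<open>rec_fun n A\<close> says
  nothing. Functions defined by such sums are therefore treated on bare variables, and arguments are
  substituted afterwards.\<close>

lemma rec_fun_compose:
  assumes "rec_fun 1 (\<lambda>x e. h x (e 0))" and "rec_fun n A"
  shows "rec_fun n (\<lambda>x e. h x (A x e))"
proof -
  obtain f where f: "\<And>x e. oeval x f (map e [0..<1]) (h x (e 0))"
    using assms(1) unfolding rec_fun_def by blast
  obtain a where a: "\<And>x e. oeval x a (map e [0..<n]) (A x e)"
    using assms(2) unfolding rec_fun_def by blast
  have "oeval x f [m] (h x m)" for x m
    using f[of x "\<lambda>_. m"] by simp
  with a show ?thesis
    unfolding rec_fun_def
    by (intro exI[of _ "Comp f [a]"] allI oeval.Comp[where bs = "[A x e]" for x e]) auto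
qed

lemma rec_fun_compose2:
  assumes "rec_fun 2 (\<lambda>x e. h x (e 0) (e (Suc 0)))" and "rec_fun n A" and "rec_fun n B"
  shows "rec_fun n (\<lambda>x e. h x (A x e) (B x e))"
proof -
  obtain f where f: "\<And>x e. oeval x f (map e [0..<2]) (h x (e 0) (e (Suc 0)))"
    using assms(1) unfolding rec_fun_def by blast
  obtain a where a: "\<And>x e. oeval x a (map e [0..<n]) (A x e)"
    using assms(2) unfolding rec_fun_def by blast
  obtain b where b: "\<And>x e. oeval x b (map e [0..<n]) (B x e)"
    using assms(3) unfolding rec_fun_def by blast
  have "oeval x f [l, m] (h x l m)" for x l m
    using f[of x "case_nat l (\<lambda>_. m)"] by (simp add: upt_rec)
  with a b show ?thesis
    unfolding rec_fun_def
    by (intro exI[of _ "Comp f [a, b]"] allI oeval.Comp[where bs = "[A x e, B x e]" for x e]) auto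
qed

section \<open>Arithmetic and bounded quantifiers\<close>

lemma rec_fun_add:
  assumes "rec_fun n A" and "rec_fun n B"
  shows "rec_fun n (\<lambda>x e. A x e + B x e)"
proof -
  have "rec_fun n (\<lambda>x e. rec_nat (A x e) (\<lambda>m q. Suc q) (B x e))"
    using assms by (intro rec_fun_rec_nat rec_fun_Suc rec_fun_proj) auto
  moreover have "rec_nat a (\<lambda>m q. Suc q) b = a + b" for a b
    by (induction b) auto
  ultimately show ?thesis by simp
qed

lemma rec_fun_pred:
  assumes "rec_fun n A"
  shows "rec_fun n (\<lambda>x e. A x e - 1)"
proof -
  have "rec_fun n (\<lambda>x e. rec_nat 0 (\<lambda>m q. m) (A x e))"
    using assms by (intro rec_fun_rec_nat rec_fun_const rec_fun_proj) auto
  moreover have "rec_nat 0 (\<lambda>m q. m) a = a - 1" for a :: nat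
    by (cases a) auto
  ultimately show ?thesis by simp
qed

lemma rec_fun_diff:
  assumes "rec_fun n A" and "rec_fun n B"
  shows "rec_fun n (\<lambda>x e. A x e - B x e)"
proof -
  have "rec_fun n (\<lambda>x e. rec_nat (A x e) (\<lambda>m q. q - 1) (B x e))"
    using assms by (intro rec_fun_rec_nat rec_fun_pred rec_fun_proj) auto
  moreover have "rec_nat a (\<lambda>m q. q - 1) b = a - b" for a b :: nat
    by (induction b) auto
  ultimately show ?thesis by simp
qed

lemma rec_fun_sum:
  assumes "rec_fun n N" and "rec_fun (Suc n) (\<lambda>x e. F x (e 0) (\<lambda>i. e (Suc i)))"
  shows "rec_fun n (\<lambda>x e. \<Sum>j<N x e. F x j e)"
proof -
  obtain f where f: "\<And>x e. oeval x f (map e [0..<Suc n]) (F x (e 0) (\<lambda>i. e (Suc i)))"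
    using assms(2) unfolding rec_fun_def by blast
  have f': "oeval x f (m # map e [0..<n]) (F x m e)" for x m e
    using f[of x "case_nat m e"] by (simp add: map_upt_Suc del: upt_Suc)
  have "rec_fun (Suc (Suc n)) (\<lambda>x e. F x (e 0) (\<lambda>i. e (Suc (Suc i))))"
    unfolding rec_fun_def
  proof (intro exI allI)
    fix x :: baire and e :: "nat \<Rightarrow> nat"
    let ?as = "map e [0..<Suc (Suc n)]"
    \<comment> \<open>Index 1 is skipped: there the recursion keeps the partial sum, which the
      summand must not see.\<close>
    let ?ps = "0 # map (\<lambda>i. Suc (Suc i)) [0..<n]"
    show "oeval x (Comp f (map Proj ?ps)) ?as (F x (e 0) (\<lambda>i. e (Suc (Suc i))))"
    proof (rule oeval.Comp)
      have "oeval x (Proj i) ?as (e i)" if "i < Suc (Suc n)" for i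
        using oeval.Proj[of i ?as x] that by (simp del: upt_Suc)
      then show "list_all2 (\<lambda>g b. oeval x g ?as b) (map Proj ?ps) (map e ?ps)"
        by (auto simp: list_all2_map1 list_all2_map2 list_all2_same simp del: upt_Suc)
      show "oeval x f (map e ?ps) (F x (e 0) (\<lambda>i. e (Suc (Suc i))))"
        using f'[of x "e 0" "\<lambda>i. e (Suc (Suc i))"] by (simp add: comp_def)
    qed
  qed
  then have "rec_fun n (\<lambda>x e. rec_nat 0 (\<lambda>m q. q + F x m e) (N x e))"
    using assms(1) by (intro rec_fun_rec_nat rec_fun_const rec_fun_add rec_fun_proj) auto
  moreover have "rec_nat 0 (\<lambda>m q. q + h m) b = (\<Sum>j<b. h j)" for h :: "nat \<Rightarrow> nat" and b
    by (induction b) auto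
  ultimately show ?thesis by simp
qed

lemma rec_fun_mult:
  assumes "rec_fun n A" and "rec_fun n B"
  shows "rec_fun n (\<lambda>x e. A x e * B x e)"
proof (rule rec_fun_compose2[OF _ assms])
  have "rec_fun 2 (\<lambda>x e. \<Sum>j<e 0. e (Suc 0))"
    by (intro rec_fun_sum rec_fun_proj) auto
  then show "rec_fun 2 (\<lambda>x e. e 0 * e (Suc 0))" by simp
qed

lemma rec_fun_of_bool: "rec_pred n P \<Longrightarrow> rec_fun n (\<lambda>x e. of_bool (P x e))"
  unfolding rec_pred_def .

lemma rec_pred_not:
  assumes "rec_pred n P"
  shows "rec_pred n (\<lambda>x e. \<not> P x e)"
proof -
  have "rec_fun n (\<lambda>x e. 1 - of_bool (P x e))"
    using assms by (intro rec_fun_diff rec_fun_const rec_fun_of_bool)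
  moreover have "1 - of_bool b = (of_bool (\<not> b) :: nat)" for b by auto
  ultimately show ?thesis by (simp only: rec_pred_def)
qed

lemma rec_pred_conj:
  assumes "rec_pred n P" and "rec_pred n Q"
  shows "rec_pred n (\<lambda>x e. P x e \<and> Q x e)"
  using rec_fun_mult[OF assms[unfolded rec_pred_def]]
  by (simp add: rec_pred_def of_bool_conj)

lemma rec_pred_disj:
  assumes "rec_pred n P" and "rec_pred n Q"
  shows "rec_pred n (\<lambda>x e. P x e \<or> Q x e)"
  using rec_pred_not[OF rec_pred_conj[OF assms[THEN rec_pred_not]]] by simp

lemma rec_pred_imp:
  assumes "rec_pred n P" and "rec_pred n Q"
  shows "rec_pred n (\<lambda>x e. P x e \<longrightarrow> Q x e)"
  using rec_pred_disj[OF rec_pred_not[OF assms(1)] assms(2)] by (simp only: imp_conv_disj)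

lemma rec_pred_eq_0:
  assumes "rec_fun n A"
  shows "rec_pred n (\<lambda>x e. A x e = 0)"
proof -
  have "rec_fun n (\<lambda>x e. 1 - A x e)"
    using assms by (intro rec_fun_diff rec_fun_const)
  moreover have "1 - a = of_bool (a = 0)" for a :: nat by auto
  ultimately show ?thesis by (simp add: rec_pred_def)
qed

lemma rec_pred_le:
  assumes "rec_fun n A" and "rec_fun n B"
  shows "rec_pred n (\<lambda>x e. A x e \<le> B x e)"
  using rec_pred_eq_0[OF rec_fun_diff[OF assms]] by simp

lemma rec_pred_less:
  assumes "rec_fun n A" and "rec_fun n B"
  shows "rec_pred n (\<lambda>x e. A x e < B x e)"
  using rec_pred_le[OF rec_fun_Suc[OF assms(1)] assms(2)] by (simp add: Suc_le_eq)

lemma rec_pred_eq: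
  assumes "rec_fun n A" and "rec_fun n B"
  shows "rec_pred n (\<lambda>x e. A x e = B x e)"
  using rec_pred_conj[OF rec_pred_le[OF assms] rec_pred_le[OF assms(2,1)]]
  by (simp add: eq_iff)

text \<open>The number of counterexamples below the bound is a bounded sum, and it must
  vanish.\<close>

lemma rec_pred_all:
  assumes "rec_fun n N" and "rec_pred (Suc n) (\<lambda>x e. P x (e 0) (\<lambda>i. e (Suc i)))"
  shows "rec_pred n (\<lambda>x e. \<forall>j<N x e. P x j e)"
proof -
  have "rec_pred n (\<lambda>x e. (\<Sum>j<N x e. of_bool (\<not> P x j e)) = (0::nat))"
    using assms by (intro rec_pred_eq_0 rec_fun_sum rec_fun_of_bool rec_pred_not)
  moreover have "(\<Sum>j<b. of_bool (\<not> Q j)) = (0::nat) \<longleftrightarrow> (\<forall>j<b. Q j)" for Q and b :: nat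
    by auto
  ultimately show ?thesis by (simp only:)
qed

lemma rec_pred_ex:
  assumes "rec_fun n N" and "rec_pred (Suc n) (\<lambda>x e. P x (e 0) (\<lambda>i. e (Suc i)))"
  shows "rec_pred n (\<lambda>x e. \<exists>j<N x e. P x j e)"
  using rec_pred_not[OF rec_pred_all[OF assms(1) rec_pred_not[OF assms(2)]]] by simp

section \<open>Codes of pairs and lists\<close>

lemma rec_fun_prod_encode:
  assumes "rec_fun n A" and "rec_fun n B"
  shows "rec_fun n (\<lambda>x e. prod_encode (A x e, B x e))"
proof (rule rec_fun_compose2[OF _ assms])
  have "rec_fun 2 (\<lambda>x e. (\<Sum>j<Suc (e 0 + e (Suc 0)). j) + e 0)"
    by (intro rec_fun_sum rec_fun_add rec_fun_Suc rec_fun_proj) auto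
  moreover have "triangle m = (\<Sum>j<Suc m. j)" for m
    by (induction m) auto
  ultimately show "rec_fun 2 (\<lambda>x e. prod_encode (e 0, e (Suc 0)))"
    by (simp add: prod_encode_def)
qed

text \<open>Both components of a pair are at most its code, so a bounded sum finds them: only the
  right candidate contributes.\<close>

lemma rec_fun_fst_prod_decode:
  assumes "rec_fun n A"
  shows "rec_fun n (\<lambda>x e. fst (prod_decode (A x e)))"
proof (rule rec_fun_compose[OF _ assms])
  have "rec_fun 1 (\<lambda>x e. \<Sum>a<Suc (e 0). a * of_bool (\<exists>b<Suc (e 0). prod_encode (a, b) = e 0))"
    by (intro rec_fun_sum rec_fun_mult rec_fun_of_bool rec_pred_ex rec_pred_eq
        rec_fun_prod_encode rec_fun_Suc rec_fun_proj) auto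
  moreover have "(\<Sum>a<Suc m. a * of_bool (\<exists>b<Suc m. prod_encode (a, b) = m)) = fst (prod_decode m)" for m
  proof -
    have "(\<exists>b<Suc m. prod_encode (a, b) = m) \<longleftrightarrow> a = fst (prod_decode m)" for a
      by (metis fst_conv le_imp_less_Suc le_prod_encode_2 prod.collapse prod_decode_inverse
          prod_encode_inverse)
    moreover have "fst (prod_decode m) < Suc m"
      by (metis le_imp_less_Suc le_prod_encode_1 prod.collapse prod_decode_inverse)
    ultimately show ?thesis by (simp add: of_bool_def if_distrib cong: if_cong)
  qed
  ultimately show "rec_fun 1 (\<lambda>x e. fst (prod_decode (e 0)))" by simp
qed

lemma rec_fun_snd_prod_decode:
  assumes "rec_fun n A"
  shows "rec_fun n (\<lambda>x e. snd (prod_decode (A x e)))"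
proof (rule rec_fun_compose[OF _ assms])
  have "rec_fun 1 (\<lambda>x e. \<Sum>b<Suc (e 0). b * of_bool (\<exists>a<Suc (e 0). prod_encode (a, b) = e 0))"
    by (intro rec_fun_sum rec_fun_mult rec_fun_of_bool rec_pred_ex rec_pred_eq
        rec_fun_prod_encode rec_fun_Suc rec_fun_proj) auto
  moreover have "(\<Sum>b<Suc m. b * of_bool (\<exists>a<Suc m. prod_encode (a, b) = m)) = snd (prod_decode m)" for m
  proof -
    have "(\<exists>a<Suc m. prod_encode (a, b) = m) \<longleftrightarrow> b = snd (prod_decode m)" for b
      by (metis snd_conv le_imp_less_Suc le_prod_encode_1 prod.collapse prod_decode_inverse
          prod_encode_inverse)
    moreover have "snd (prod_decode m) < Suc m"
      by (metis le_imp_less_Suc le_prod_encode_2 prod.collapse prod_decode_inverse)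
    ultimately show ?thesis by (simp add: of_bool_def if_distrib cong: if_cong)
  qed
  ultimately show "rec_fun 1 (\<lambda>x e. snd (prod_decode (e 0)))" by simp
qed

section \<open>Suffixes, lengths and entries of coded lists\<close>

lemma prod_decode_0: "prod_decode 0 = (0, 0)"
  using prod_encode_inverse[of "(0, 0)"] by (simp add: prod_encode_def)

lemma rec_fun_drop:
  assumes "rec_fun n A" and "rec_fun n B"
  shows "rec_fun n (\<lambda>x e. list_encode (drop (B x e) (list_decode (A x e))))"
proof -
  have "rec_fun n (\<lambda>x e. rec_nat (A x e) (\<lambda>m q. snd (prod_decode (q - 1))) (B x e))"
    using assms by (intro rec_fun_rec_nat rec_fun_snd_prod_decode rec_fun_pred rec_fun_proj) auto
  \<comment> \<open>The code of a nonempty list is the successor of the pair code of its head and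
    its coded tail. For the empty list, truncated subtraction and
    \<open>prod_decode 0 = (0, 0)\<close> keep the code 0.\<close>
  moreover have tl: "snd (prod_decode (list_encode xs - 1)) = list_encode (tl xs)" for xs
    by (cases xs) (auto simp: prod_decode_0)
  have "rec_nat a (\<lambda>m q. snd (prod_decode (q - 1))) b = list_encode (drop b (list_decode a))" for a b
    by (induction b) (simp_all add: tl[unfolded One_nat_def] drop_Suc tl_drop)
  ultimately show ?thesis by simp
qed

lemma length_list_decode_le: "length (list_decode m) \<le> m"
proof -
  have "length xs \<le> list_encode xs" for xs
  proof (induction xs)
    case (Cons a xs)
    then show ?case using le_prod_encode_2[of "list_encode xs" a] by simp
  qed simp
  from this[of "list_decode m"] show ?thesis by simp
qed

text \<open>The length counts the nonempty suffixes; since it is at most the code, counting below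
  the code suffices.\<close>

lemma rec_fun_length:
  assumes "rec_fun n A"
  shows "rec_fun n (\<lambda>x e. length (list_decode (A x e)))"
proof (rule rec_fun_compose[OF _ assms])
  have "rec_fun 1 (\<lambda>x e. \<Sum>j<e 0. of_bool (\<not> list_encode (drop j (list_decode (e 0))) = 0))"
    by (intro rec_fun_sum rec_fun_of_bool rec_pred_not rec_pred_eq_0 rec_fun_drop rec_fun_proj) auto
  moreover have "(\<Sum>j<m. of_bool (\<not> list_encode (drop j (list_decode m)) = 0)) = length (list_decode m)" for m
  proof -
    have "(list_encode xs = 0) = (xs = [])" for xs
      by (cases xs) auto
    then have "(\<Sum>j<m. of_bool (\<not> list_encode (drop j (list_decode m)) = 0))
        = card {j. j < m \<and> j < length (list_decode m)}"
      by (simp add: not_le sum.If_cases of_bool_def Int_def)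
    also have "{j. j < m \<and> j < length (list_decode m)} = {..<length (list_decode m)}"
      using length_list_decode_le[of m] by auto
    finally show ?thesis by simp
  qed
  ultimately show "rec_fun 1 (\<lambda>x e. length (list_decode (e 0)))" by simp
qed

text \<open>The default 0 is what decoding gives at the code of the empty suffix, so entries are
  computable without a case distinction.\<close>

definition nth0 :: "nat list \<Rightarrow> nat \<Rightarrow> nat" where
  "nth0 xs i = (if i < length xs then xs ! i else 0)"

lemma rec_fun_nth0:
  assumes "rec_fun n A" and "rec_fun n B"
  shows "rec_fun n (\<lambda>x e. nth0 (list_decode (A x e)) (B x e))"
proof -
  have "rec_fun n (\<lambda>x e. fst (prod_decode (list_encode (drop (B x e) (list_decode (A x e))) - 1)))"
    using assms by (intro rec_fun_fst_prod_decode rec_fun_pred rec_fun_drop)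
  moreover have "fst (prod_decode (list_encode (drop i xs) - 1)) = nth0 xs i" for xs i
  proof (cases "i < length xs")
    case True
    then show ?thesis by (simp add: nth0_def flip: Cons_nth_drop_Suc)
  qed (simp add: nth0_def prod_decode_0)
  ultimately show ?thesis by simp
qed

lemmas rec_intros =
  rec_fun_const rec_fun_proj rec_fun_oracle rec_fun_Suc rec_fun_add rec_fun_mult rec_fun_diff
  rec_fun_of_bool rec_fun_prod_encode rec_fun_fst_prod_decode rec_fun_snd_prod_decode
  rec_fun_length rec_fun_nth0
  rec_pred_not rec_pred_conj rec_pred_disj rec_pred_imp rec_pred_all rec_pred_ex
  rec_pred_le rec_pred_less rec_pred_eq

section \<open>Reductions that flip the answer\<close>

text \<open>The backward functional maps \<open>y\<close> to \<open>1 - y 0\<close> without access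
  to the input, as strong reducibility requires. The values must match for every \<open>b\<close>
  named by \<open>\<Phi> p\<close>, since a solution may refer to any of them.\<close>

lemma sW_reducible_flip:
  assumes "rec_fun 1 (\<lambda>x e. \<Phi> x (e 0))"
    and "\<And>p a. \<delta> p a \<Longrightarrow> \<exists>b. \<delta>' (\<Phi> p) b"
    and "\<And>p a b. \<delta> p a \<Longrightarrow> \<delta>' (\<Phi> p) b \<Longrightarrow> F a = 1 - F' b"
  shows "number_problem \<delta> F \<le>\<^sub>s\<^sub>W number_problem \<delta>' F'"
proof -
  have "rec_fun 1 (\<lambda>x e. 1 - x 0)"
    by (intro rec_intros)
  then have "computable_functional (\<lambda>y. Some (\<lambda>_. 1 - y 0))"
    by (intro computable_functional_total)
  moreover have "computable_functional (\<lambda>x. Some (\<Phi> x))"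
    using assms(1) by (rule computable_functional_total)
  moreover have "\<Phi> x \<in> inputs (number_problem \<delta>' F') \<and>
      (\<forall>y \<in> solutions (number_problem \<delta>' F') (\<Phi> x).
        (\<lambda>_. 1 - y 0) \<in> solutions (number_problem \<delta> F) x)"
    if x: "x \<in> inputs (number_problem \<delta> F)" for x
  proof -
    obtain a where "\<delta> x a"
      using x by (auto simp: number_problem_def)
    then show ?thesis
      using assms(2,3) by (auto simp: number_problem_def intro!: exI[of _ a])
  qed
  ultimately show ?thesis
    unfolding sW_reducible_def by blast
qed

section \<open>From colorings to paths\<close>

text \<open>Entry \<open>i\<close> of a node is a pair of a color for vertex \<open>i\<close> and a certificate for edge \<open>i\<close>:
  \<open>0\<close> claims that the edge has less than two vertices, and the successor of the code of \<open>(u, v)\<close>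
  claims that \<open>u\<close> and \<open>v\<close> are vertices of the edge with different colors.  A node is discarded
  as soon as one of its claims is refuted by vertices below its length.\<close>

definition color_at :: "nat list \<Rightarrow> nat \<Rightarrow> nat" where
  "color_at \<sigma> i = fst (prod_decode (nth0 \<sigma> i))"

definition cert_at :: "nat list \<Rightarrow> nat \<Rightarrow> nat" where
  "cert_at \<sigma> i = snd (prod_decode (nth0 \<sigma> i))"

definition edge_ok :: "nat set \<Rightarrow> nat list \<Rightarrow> nat \<Rightarrow> bool" where
  "edge_ok A \<sigma> c \<longleftrightarrow>
     (c = 0 \<longrightarrow> (\<forall>u<length \<sigma>. \<forall>v<length \<sigma>. u \<in> A \<and> v \<in> A \<longrightarrow> u = v)) \<and>
     (\<not> c = 0 \<longrightarrow> fst (prod_decode (c - 1)) \<in> A \<and> snd (prod_decode (c - 1)) \<in> A \<and>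
        (fst (prod_decode (c - 1)) < length \<sigma> \<and> snd (prod_decode (c - 1)) < length \<sigma> \<longrightarrow>
          \<not> color_at \<sigma> (fst (prod_decode (c - 1))) = color_at \<sigma> (snd (prod_decode (c - 1)))))"

definition coloring_tree :: "nat \<Rightarrow> hypergraph \<Rightarrow> nat list set" where
  "coloring_tree k H = {\<sigma>. \<forall>i<length \<sigma>. color_at \<sigma> i < k \<and>
     (i \<in> edge_ixs H \<longrightarrow> edge_ok (edge H i) \<sigma> (cert_at \<sigma> i))}"

lemma is_tree_coloring_tree: "is_tree (coloring_tree k H)"
  unfolding is_tree_def
proof (intro ballI allI impI)
  fix \<sigma> \<tau> assume \<sigma>: "\<sigma> \<in> coloring_tree k H" and "prefix \<tau> \<sigma>"
  then have le: "length \<tau> \<le> length \<sigma>" and "\<And>i. i < length \<tau> \<Longrightarrow> nth0 \<tau> i = nth0 \<sigma> i"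
    by (auto simp: prefix_def nth0_def nth_append)
  then have "\<And>i. i < length \<tau> \<Longrightarrow> color_at \<tau> i = color_at \<sigma> i"
    and "\<And>i. i < length \<tau> \<Longrightarrow> cert_at \<tau> i = cert_at \<sigma> i"
    by (simp_all add: color_at_def cert_at_def)
  moreover from this le have "edge_ok A \<sigma> c \<Longrightarrow> edge_ok A \<tau> c" for A c
    unfolding edge_ok_def by fastforce
  ultimately show "\<tau> \<in> coloring_tree k H"
    using \<sigma> le by (simp add: coloring_tree_def)
qed

lemma infinite_path_coloring_tree_iff:
  assumes H: "is_hypergraph H" and "0 < k"
  shows "(\<exists>g. infinite_path (coloring_tree k H) g) \<longleftrightarrow> (\<exists>f. coloring k H f \<and> proper H f)"
proof
  assume "\<exists>g. infinite_path (coloring_tree k H) g"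
  then obtain g where g: "\<And>n. map g [0..<n] \<in> coloring_tree k H"
    unfolding infinite_path_def by blast
  define f where "f v = fst (prod_decode (g v))" for v
  have f: "color_at (map g [0..<n]) i = f i" if "i < n" for n i
    using that by (simp add: color_at_def nth0_def f_def)
  have "f v < k" for v
    using g[of "Suc v"] f[of v "Suc v"] by (auto simp: coloring_tree_def simp del: upt_Suc)
  moreover have "\<exists>u \<in> edge H i. \<exists>v \<in> edge H i. f u \<noteq> f v"
    if i: "i \<in> edge_ixs H" and uv: "u \<in> edge H i" "v \<in> edge H i" "u \<noteq> v" for i u v
  proof -
    define c where "c = snd (prod_decode (g i))"
    obtain a b where ab: "prod_decode (c - 1) = (a, b)"
      by fastforce
    \<comment> \<open>The node is long enough to contain entry \<open>i\<close>, the vertices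
      \<open>u\<close>, \<open>v\<close> that refute certificate 0, and the pair \<open>a\<close>,
      \<open>b\<close> whose colors must then differ.\<close>
    define n where "n = Suc (i + u + v + a + b)"
    have "edge_ok (edge H i) (map g [0..<n]) c"
      using g[of n] i by (auto simp: coloring_tree_def cert_at_def c_def nth0_def n_def simp del: upt_Suc)
    then have "c \<noteq> 0" "a \<in> edge H i" "b \<in> edge H i"
        "color_at (map g [0..<n]) a \<noteq> color_at (map g [0..<n]) b"
      using uv ab by (auto simp: edge_ok_def n_def simp del: upt_Suc)
    then show ?thesis
      using f[of a n] f[of b n] by (auto simp: n_def simp del: upt_Suc)
  qed
  ultimately show "\<exists>f. coloring k H f \<and> proper H f"
    unfolding coloring_def proper_def by blast
next
  assume "\<exists>f. coloring k H f \<and> proper H f"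
  then obtain f where f: "\<And>v. v \<in> verts H \<Longrightarrow> f v < k" and "proper H f"
    unfolding coloring_def by blast
  \<comment> \<open>The tree bounds the color at every index, also outside \<open>verts H\<close>,
    so the coloring is extended by 0; this uses \<open>0 < k\<close>.\<close>
  define f' where "f' v = (if v \<in> verts H then f v else 0)" for v
  have f'_eq: "f' v = f v" if "i \<in> edge_ixs H" "v \<in> edge H i" for i v
    using that H by (auto simp: f'_def is_hypergraph_def)
  have "\<exists>c. i \<in> edge_ixs H \<longrightarrow>
      (if c = 0 then \<forall>u\<in>edge H i. \<forall>v\<in>edge H i. u = v
       else \<exists>u\<in>edge H i. \<exists>v\<in>edge H i. prod_decode (c - 1) = (u, v) \<and> f' u \<noteq> f' v)" for i
  proof (cases "i \<in> edge_ixs H \<and> (\<exists>u\<in>edge H i. \<exists>v\<in>edge H i. u \<noteq> v)")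
    case True
    then obtain u v where "u \<in> edge H i" "v \<in> edge H i" "f' u \<noteq> f' v"
      using \<open>proper H f\<close> f'_eq unfolding proper_def by metis
    then show ?thesis
      by (intro exI[of _ "Suc (prod_encode (u, v))"]) auto
  qed (auto intro: exI[of _ 0])
  then obtain c where c: "\<And>i. i \<in> edge_ixs H \<Longrightarrow>
      (if c i = 0 then \<forall>u\<in>edge H i. \<forall>v\<in>edge H i. u = v
       else \<exists>u\<in>edge H i. \<exists>v\<in>edge H i. prod_decode (c i - 1) = (u, v) \<and> f' u \<noteq> f' v)"
    by metis
  define g where "g i = prod_encode (f' i, c i)" for i
  have color: "color_at (map g [0..<n]) i = f' i" and cert: "cert_at (map g [0..<n]) i = c i"
    if "i < n" for i n
    using that by (simp_all add: color_at_def cert_at_def nth0_def g_def)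
  have "edge_ok (edge H i) (map g [0..<n]) (c i)" if "i \<in> edge_ixs H" for i n
    using c[OF that] by (auto simp: edge_ok_def color split: if_splits)
  moreover have "f' i < k" for i
    using f \<open>0 < k\<close> by (simp add: f'_def)
  ultimately have "infinite_path (coloring_tree k H) g"
    by (simp add: infinite_path_def coloring_tree_def color cert)
  then show "\<exists>g. infinite_path (coloring_tree k H) g" by blast
qed

section \<open>Computing the coloring tree from a name of the hypergraph\<close>

definition named_hypergraph :: "baire \<Rightarrow> hypergraph" where
  "named_hypergraph p =
     \<lparr>verts = {v. p (prod_encode (0, v)) = 1}, edge_ixs = {i. p (prod_encode (1, i)) = 1},
      edge = (\<lambda>i. {v. p (prod_encode (i + 2, v)) = 1})\<rparr>"

text \<open>A name leaves \<open>edge H\<close> open outside \<open>edge_ixs H\<close>, but the tree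
  never consults those edges.\<close>

lemma coloring_tree_named_hypergraph:
  assumes "hypergraph_name p H"
  shows "coloring_tree k (named_hypergraph p) = coloring_tree k H"
proof -
  have "edge_ixs (named_hypergraph p) = edge_ixs H"
    and "\<And>i. i \<in> edge_ixs H \<Longrightarrow> edge (named_hypergraph p) i = edge H i"
    using assms by (auto simp: hypergraph_name_def named_hypergraph_def)
  then show ?thesis by (auto simp: coloring_tree_def)
qed

lemma tree_name_unique: "tree_name p T \<Longrightarrow> tree_name p T' \<Longrightarrow> T = T'"
  unfolding tree_name_def by (intro set_eqI) (metis of_bool_eq_iff)

lemma HPC_reducible_WF:
  assumes "k \<ge> 2"
  shows "HPC k \<le>\<^sub>s\<^sub>W WF"
  unfolding HPC_def WF_def
proof (rule sW_reducible_flip)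
  let ?\<Phi> = "\<lambda>p m. of_bool (list_decode m \<in> coloring_tree k (named_hypergraph p)) :: nat"
  \<comment> \<open>Unfolded, membership consists of bounded quantifiers, decoding, arithmetic and
    oracle queries.\<close>
  show "rec_fun 1 (\<lambda>x e. ?\<Phi> x (e 0))"
    unfolding coloring_tree_def edge_ok_def color_at_def cert_at_def named_hypergraph_def
      mem_Collect_eq hypergraph.simps
    by (intro rec_intros) simp_all
  have \<Phi>: "tree_name (?\<Phi> p) (coloring_tree k H)" if "hypergraph_name p H" for p H
    by (simp add: tree_name_def is_tree_coloring_tree coloring_tree_named_hypergraph[OF that])
  then show "\<exists>T. tree_name (?\<Phi> p) T" if "hypergraph_name p H" for p H
    using that by blast
  fix p H T assume H: "hypergraph_name p H" and T: "tree_name (?\<Phi> p) T"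
  have "T = coloring_tree k H"
    using T \<Phi>[OF H] by (rule tree_name_unique)
  moreover have "is_hypergraph H"
    using H by (simp add: hypergraph_name_def)
  ultimately show "(if \<exists>f. coloring k H f \<and> proper H f then 1 else 0) =
      1 - (if \<exists>g. infinite_path T g then 0 else 1 :: nat)"
    using infinite_path_coloring_tree_iff[of H k] assms by simp
qed

section \<open>From paths to colorings\<close>

text \<open>Vertex \<open>0\<close> carries the color "false", and the \<open>k - 2\<close> vertices \<open>a\<close> with
  \<open>0 < a < k - 1\<close> use up all colors but two.  The literals "\<open>\<sigma>\<close> is on the path" and
  "\<open>\<sigma>\<close> is not on the path" are vertices \<open>pos k (list_encode \<sigma>)\<close> and \<open>neg k (list_encode \<sigma>)\<close>; an edge
  that contains vertex \<open>0\<close> is the clause of its other vertices.\<close>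

definition pos :: "nat \<Rightarrow> nat \<Rightarrow> nat" where "pos k m = k - 1 + 2 * m"
definition neg :: "nat \<Rightarrow> nat \<Rightarrow> nat" where "neg k m = k + 2 * m"

text \<open>Lengths and a bounded comparison of entries bring one-entry extension into the scope of
  the computability rules.\<close>

definition child :: "nat list \<Rightarrow> nat list \<Rightarrow> bool" where
  "child \<sigma> \<tau> \<longleftrightarrow> length \<tau> = Suc (length \<sigma>) \<and> (\<forall>i<length \<sigma>. nth0 \<tau> i = nth0 \<sigma> i)"

text \<open>The number \<open>t\<close> selects a constraint: 0 gives a node on the path a child in
  \<open>T\<close> on the path, 1 makes the two literals of a node opposite, 2 puts the root on the
  path, and larger \<open>t\<close> join the auxiliary vertex \<open>t - 2\<close> to vertex
  \<open>m\<close>.\<close>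

definition path_edge :: "nat \<Rightarrow> nat list set \<Rightarrow> nat \<Rightarrow> nat \<Rightarrow> nat set" where
  "path_edge k T t m = {v.
     (t = 0 \<and> (v = 0 \<or> v = neg k m \<or>
        (\<exists>c<Suc v. v = pos k c \<and> list_decode c \<in> T \<and> child (list_decode m) (list_decode c)))) \<or>
     (t = 1 \<and> (v = pos k m \<or> v = neg k m)) \<or>
     (t = 2 \<and> (v = 0 \<or> v = pos k 0)) \<or>
     (2 < t \<and> t - 2 < k - 1 \<and> (v = t - 2 \<or> v = m))}"

definition path_hypergraph :: "nat \<Rightarrow> nat list set \<Rightarrow> hypergraph" where
  "path_hypergraph k T = \<lparr>verts = UNIV, edge_ixs = UNIV,
     edge = (\<lambda>i. path_edge k T (fst (prod_decode i)) (snd (prod_decode i)))\<rparr>"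

lemma child_iff: "child \<sigma> \<tau> \<longleftrightarrow> (\<exists>a. \<tau> = \<sigma> @ [a])"
proof
  assume "child \<sigma> \<tau>"
  then have len: "length \<tau> = Suc (length \<sigma>)" and nth: "\<And>i. i < length \<sigma> \<Longrightarrow> \<tau> ! i = \<sigma> ! i"
    by (auto simp: child_def nth0_def)
  have "take (length \<sigma>) \<tau> = \<sigma>"
    by (rule nth_equalityI) (simp_all add: len nth)
  then have "\<tau> = \<sigma> @ [\<tau> ! length \<sigma>]"
    using take_Suc_conv_app_nth[of "length \<sigma>" \<tau>] len by simp
  then show "\<exists>a. \<tau> = \<sigma> @ [a]" ..
next
  assume "\<exists>a. \<tau> = \<sigma> @ [a]"
  then show "child \<sigma> \<tau>"
    by (auto simp: child_def nth0_def nth_append)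
qed

text \<open>The search bound on \<open>c\<close>, there for computability, excludes no child because
  \<open>c \<le> pos k c\<close>.\<close>

lemma mem_path_edge_0:
  "v \<in> path_edge k T 0 m \<longleftrightarrow> v = 0 \<or> v = neg k m \<or>
     (\<exists>a. list_decode m @ [a] \<in> T \<and> v = pos k (list_encode (list_decode m @ [a])))"
proof -
  have "(\<exists>c<Suc v. v = pos k c \<and> list_decode c \<in> T \<and> child (list_decode m) (list_decode c)) \<longleftrightarrow>
    (\<exists>c. v = pos k c \<and> list_decode c \<in> T \<and> child (list_decode m) (list_decode c))"
    by (auto simp: pos_def)
  also have "\<dots> \<longleftrightarrow> (\<exists>a. list_decode m @ [a] \<in> T \<and> v = pos k (list_encode (list_decode m @ [a])))"
    unfolding child_iff by (metis list_decode_inverse list_encode_inverse)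
  finally show ?thesis by (simp add: path_edge_def)
qed

lemma proper_path_hypergraph_iff:
  "proper (path_hypergraph k T) f \<longleftrightarrow>
     (\<forall>t m. (\<exists>u \<in> path_edge k T t m. \<exists>v \<in> path_edge k T t m. u \<noteq> v) \<longrightarrow>
        (\<exists>u \<in> path_edge k T t m. \<exists>v \<in> path_edge k T t m. f u \<noteq> f v))"
proof -
  have "(\<forall>i. Q (fst (prod_decode i)) (snd (prod_decode i))) \<longleftrightarrow> (\<forall>t m. Q t m)"
    (is "?L \<longleftrightarrow> ?R") for Q :: "nat \<Rightarrow> nat \<Rightarrow> bool"
  proof
    assume ?L
    then have "Q (fst (prod_decode (prod_encode (t, m)))) (snd (prod_decode (prod_encode (t, m))))"
      for t m by blast
    then show ?R by simp
  qed simp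
  then show ?thesis
    by (simp only: proper_def path_hypergraph_def hypergraph.simps ball_UNIV)
qed

text \<open>Color 0 means false and 1 true; a literal gets its truth value with respect to
  \<open>g\<close>, and each auxiliary vertex gets a color of its own, between 2 and
  \<open>k - 1\<close>.\<close>

lemma path_hypergraph_colorable:
  assumes "k \<ge> 2" and g: "infinite_path T g"
  shows "\<exists>f. coloring k (path_hypergraph k T) f \<and> proper (path_hypergraph k T) f"
proof -
  define on where "on \<sigma> \<longleftrightarrow> \<sigma> = map g [0..<length \<sigma>]" for \<sigma>
  \<comment> \<open>Counted from \<open>k - 1\<close>, even offsets are positive literals, odd ones
    negative, and half the offset, rounded down, is the code of the node.\<close>
  define f where "f v = (if v = 0 then 0 else if v < k - 1 then Suc v
     else of_bool (on (list_decode ((v - (k - 1)) div 2)) = even (v - (k - 1))))" for v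
  have pos: "f (pos k m) = of_bool (on (list_decode m))" for m
  proof -
    have "pos k m - (k - 1) = 2 * m" "pos k m \<noteq> 0" "\<not> pos k m < k - 1"
      using \<open>k \<ge> 2\<close> by (auto simp: pos_def)
    then show ?thesis by (simp add: f_def)
  qed
  have neg: "f (neg k m) = of_bool (\<not> on (list_decode m))" for m
  proof -
    have "neg k m - (k - 1) = Suc (2 * m)" "neg k m \<noteq> 0" "\<not> neg k m < k - 1"
      using \<open>k \<ge> 2\<close> by (auto simp: neg_def)
    then show ?thesis by (simp add: f_def)
  qed
  have zero: "f 0 = 0" by (simp add: f_def)
  have "\<exists>u \<in> path_edge k T t m. \<exists>v \<in> path_edge k T t m. f u \<noteq> f v"
    if "u \<in> path_edge k T t m" "v \<in> path_edge k T t m" "u \<noteq> v" for t m u v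
  proof -
    consider "t = 0" | "t = 1" | "t = 2" | "2 < t" by linarith
    then show ?thesis
    proof cases
      case 1
      have "0 \<in> path_edge k T t m" "neg k m \<in> path_edge k T t m"
        by (simp_all add: 1 mem_path_edge_0)
      \<comment> \<open>A node off the path has a true negative literal; a node on the path needs
        its successor along \<open>g\<close>.\<close>
      moreover have "\<exists>v \<in> path_edge k T t m. f v = 1" if "on (list_decode m)"
      proof -
        define a where "a = g (length (list_decode m))"
        have *: "list_decode m @ [a] = map g [0..<Suc (length (list_decode m))]"
          using that by (simp add: on_def a_def)
        then have "on (list_decode m @ [a])"
          unfolding on_def by (simp del: upt_Suc)
        moreover have "list_decode m @ [a] \<in> T"
          using g * by (metis infinite_path_def)
        ultimately show ?thesis
          unfolding 1
          by (intro bexI[of _ "pos k (list_encode (list_decode m @ [a]))"])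
            (auto simp: pos mem_path_edge_0)
      qed
      ultimately show ?thesis
        using zero neg[of m] by (cases "on (list_decode m)") force+
    next
      case 2
      then show ?thesis using pos[of m] neg[of m]
        by (intro bexI[of _ "pos k m"] bexI[of _ "neg k m"]) (auto simp: path_edge_def)
    next
      case 3
      have "on []" by (simp add: on_def)
      then show ?thesis using 3 zero pos[of 0]
        by (intro bexI[of _ "pos k 0"] bexI[of _ 0]) (auto simp: path_edge_def)
    next
      case 4
      then have t: "t - 2 < k - 1" "{t - 2, m} = {u, v}"
        using that by (auto simp: path_edge_def)
      then have "f (t - 2) = Suc (t - 2)" "m \<noteq> t - 2"
        using 4 \<open>u \<noteq> v\<close> by (auto simp: f_def)
      then have "f (t - 2) \<noteq> f m"
        using 4 by (auto simp: f_def)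
      then show ?thesis using 4 t
        by (intro bexI[of _ "t - 2"] bexI[of _ m]) (auto simp: path_edge_def)
    qed
  qed
  moreover have "f v < k" for v
    using \<open>k \<ge> 2\<close> by (auto simp: f_def of_bool_def)
  ultimately show ?thesis
    unfolding coloring_def proper_path_hypergraph_iff by blast
qed

text \<open>Dependent choice builds the nodes one entry at a time. Each chosen extension is in
  \<open>T\<close>, and closure under prefixes adds the root, which \<open>P []\<close> alone does
  not place in \<open>T\<close>.\<close>

lemma infinite_path_of_extension:
  assumes "is_tree T" and "P []"
    and ext: "\<And>\<sigma>. P \<sigma> \<Longrightarrow> \<exists>a. P (\<sigma> @ [a]) \<and> \<sigma> @ [a] \<in> T"
  shows "\<exists>g. infinite_path T g"
proof -
  have "\<exists>s. \<forall>n. (P (s n) \<and> (n = 0 \<longrightarrow> s n = [])) \<and>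
      (\<exists>a. s (Suc n) = s n @ [a] \<and> s (Suc n) \<in> T)"
    using \<open>P []\<close> ext
    by (intro dependent_nat_choice[where P = "\<lambda>n s. P s \<and> (n = 0 \<longrightarrow> s = [])"
        and Q = "\<lambda>n s s'. \<exists>a. s' = s @ [a] \<and> s' \<in> T"]) auto
  then obtain s where s: "\<forall>n. (P (s n) \<and> (n = 0 \<longrightarrow> s n = [])) \<and>
      (\<exists>a. s (Suc n) = s n @ [a] \<and> s (Suc n) \<in> T)" ..
  then have s0: "s 0 = []" and step: "s (Suc n) \<in> T" for n by auto
  have "\<forall>n. \<exists>a. s (Suc n) = s n @ [a]" using s by blast
  then obtain g where g: "s (Suc n) = s n @ [g n]" for n by metis
  have "map g [0..<n] = s n" for n
    by (induction n) (simp_all add: s0 g)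
  moreover have "s n \<in> T" for n
  proof -
    have "s (Suc n) \<in> T" "prefix (s n) (s (Suc n))"
      using step[of n] g[of n] by auto
    then show ?thesis using \<open>is_tree T\<close> unfolding is_tree_def by blast
  qed
  ultimately have "infinite_path T g" by (simp add: infinite_path_def)
  then show ?thesis by blast
qed

text \<open>The auxiliary vertices take \<open>k - 2\<close> distinct colors that occur nowhere
  else. Among the two colors left, a literal is true if it differs in color from vertex 0.\<close>

lemma path_hypergraph_path:
  assumes "k \<ge> 2" and "is_tree T" and "coloring k (path_hypergraph k T) f"
    and proper: "proper (path_hypergraph k T) f"
  shows "\<exists>g. infinite_path T g"
proof -
  define C where "C = f ` {0<..<k - 1}"
  have f: "f v < k" for v
    using assms(3) by (simp add: coloring_def path_hypergraph_def)
  have edge: "\<exists>w \<in> path_edge k T t m. f w \<noteq> c"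
    if "u \<in> path_edge k T t m" "v \<in> path_edge k T t m" "u \<noteq> v" for t m u v c
    using proper that unfolding proper_path_hypergraph_iff by metis
  \<comment> \<open>The edge with \<open>t = a + 2\<close> and \<open>m = v\<close> is
    \<open>{a, v}\<close>, so it cannot have a single color.\<close>
  have clique: "f a \<noteq> f v" if "0 < a" "a < k - 1" "v \<noteq> a" for a v
    using edge[of a "a + 2" v v "f a"] edge[of a "a + 2" v v "f v"] that
    by (auto simp: path_edge_def)
  have "inj_on f {0<..<k - 1}"
    by (rule inj_onI) (metis clique greaterThanLessThan_iff)
  then have "card C = k - 2"
    by (simp add: C_def card_image)
  moreover have "C \<subseteq> {..<k}"
    using f by (auto simp: C_def)
  ultimately have card: "card ({..<k} - C) = 2"
    using \<open>k \<ge> 2\<close> by (simp add: card_Diff_subset finite_subset)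
  have C: "f v \<notin> C" if "v \<notin> {0<..<k - 1}" for v
  proof
    assume "f v \<in> C"
    then obtain a where "a \<in> {0<..<k - 1}" "f v = f a"
      unfolding C_def by blast
    then show False
      using clique[of a v] that by auto
  qed
  \<comment> \<open>Two colors are left, so two vertices that both differ from a third agree:
    negation is Boolean.\<close>
  have two: "f u = f v" if "f u \<noteq> f w" "f v \<noteq> f w" "u \<notin> {0<..<k - 1}" "v \<notin> {0<..<k - 1}"
    "w \<notin> {0<..<k - 1}" for u v w
  proof (rule ccontr)
    assume "f u \<noteq> f v"
    then have "card {f u, f v, f w} = 3" using that by simp
    moreover have "{f u, f v, f w} \<subseteq> {..<k} - C"
      using that f C by simp
    ultimately show False
      using card_mono[of "{..<k} - C" "{f u, f v, f w}"] card by simp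
  qed
  define P where "P \<sigma> \<longleftrightarrow> f (pos k (list_encode \<sigma>)) \<noteq> f 0" for \<sigma>
  have pos: "pos k m \<noteq> 0" "pos k m \<notin> {0<..<k - 1}" and neg: "neg k m \<noteq> 0" "neg k m \<notin> {0<..<k - 1}"
    and pn: "pos k m \<noteq> neg k m" for m
    using \<open>k \<ge> 2\<close> by (auto simp: pos_def neg_def)
  \<comment> \<open>The root has code 0, so the edge with \<open>t = 2\<close> makes its positive
    literal true.\<close>
  have "P []"
    using edge[of 0 2 0 "pos k 0" "f 0"] pos by (auto simp: P_def path_edge_def)
  moreover have "\<exists>a. P (\<sigma> @ [a]) \<and> \<sigma> @ [a] \<in> T" if "P \<sigma>" for \<sigma>
  proof -
    define m where "m = list_encode \<sigma>"
    have "f (neg k m) \<noteq> f (pos k m)"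
      using edge[of "pos k m" 1 m "neg k m" "f (pos k m)"] pn by (auto simp: path_edge_def)
    with that have "f (neg k m) = f 0"
      using two[of "neg k m" "pos k m" 0] pos neg unfolding P_def m_def by auto
    \<comment> \<open>Vertex 0 and the negative literal now agree, so the vertex of another color in
      the clause is the literal of a child.\<close>
    then show ?thesis
      using edge[of 0 0 m "neg k m" "f 0"] neg by (auto simp: mem_path_edge_0 P_def m_def)
  qed
  ultimately show ?thesis
    using infinite_path_of_extension[OF \<open>is_tree T\<close>] by blast
qed

text \<open>A name says nothing about edges beyond the index set, so uniqueness rests on the index
  set being full.\<close>

lemma hypergraph_name_unique:
  assumes H: "hypergraph_name p H" and H': "hypergraph_name p H'" and "edge_ixs H' = UNIV"
  shows "H = H'"
proof -
  have "v \<in> verts H \<longleftrightarrow> v \<in> verts H'" for v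
    using H H' unfolding hypergraph_name_def by (metis of_bool_eq_iff)
  then have "verts H = verts H'" by (simp add: set_eq_iff)
  moreover have "i \<in> edge_ixs H \<longleftrightarrow> i \<in> edge_ixs H'" for i
    using H H' unfolding hypergraph_name_def by (metis of_bool_eq_iff)
  then have ixs: "edge_ixs H = edge_ixs H'" by (simp add: set_eq_iff)
  moreover have "v \<in> edge H i \<longleftrightarrow> v \<in> edge H' i" for i v
  proof -
    have i: "i \<in> edge_ixs H" "i \<in> edge_ixs H'"
      using assms(3) ixs by simp_all
    have "p (prod_encode (i + 2, v)) = of_bool (v \<in> edge H i)"
      using H i(1) unfolding hypergraph_name_def by blast
    moreover have "p (prod_encode (i + 2, v)) = of_bool (v \<in> edge H' i)"
      using H' i(2) unfolding hypergraph_name_def by blast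
    ultimately show ?thesis by (metis of_bool_eq_iff)
  qed
  then have "edge H i = edge H' i" for i by (simp add: set_eq_iff)
  ultimately show ?thesis by (intro hypergraph.equality) auto
qed

lemma WF_reducible_HPC:
  assumes "k \<ge> 2"
  shows "WF \<le>\<^sub>s\<^sub>W HPC k"
  unfolding HPC_def WF_def
proof (rule sW_reducible_flip)
  \<comment> \<open>First component 0 or 1 asks for vertices and edge indices, where every number
    qualifies; \<open>i + 2\<close> asks about edge \<open>i\<close>.\<close>
  let ?\<Phi> = "\<lambda>p m. of_bool (fst (prod_decode m) < 2 \<or>
    snd (prod_decode m) \<in> edge (path_hypergraph k {\<sigma>. p (list_encode \<sigma>) = 1})
      (fst (prod_decode m) - 2)) :: nat"
  \<comment> \<open>With the tree read off from \<open>p\<close>, membership of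
    \<open>list_decode c\<close> becomes the single query \<open>p c = 1\<close>.\<close>
  show "rec_fun 1 (\<lambda>x e. ?\<Phi> x (e 0))"
    unfolding path_hypergraph_def path_edge_def child_def pos_def neg_def
      mem_Collect_eq hypergraph.simps list_decode_inverse
    by (intro rec_intros) simp_all
  have \<Phi>: "hypergraph_name (?\<Phi> p) (path_hypergraph k T)" if "tree_name p T" for p T
  proof -
    have "{\<sigma>. p (list_encode \<sigma>) = 1} = T"
      using that by (auto simp: tree_name_def)
    then show ?thesis
      by (simp add: hypergraph_name_def is_hypergraph_def path_hypergraph_def)
  qed
  then show "\<exists>H. hypergraph_name (?\<Phi> p) H" if "tree_name p T" for p T
    using that by blast
  fix p T H assume T: "tree_name p T" and H: "hypergraph_name (?\<Phi> p) H"
  have "H = path_hypergraph k T"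
    using H \<Phi>[OF T] by (rule hypergraph_name_unique) (simp add: path_hypergraph_def)
  then have "(\<exists>f. coloring k H f \<and> proper H f) \<longleftrightarrow> (\<exists>g. infinite_path T g)"
    using path_hypergraph_colorable[OF assms] path_hypergraph_path[OF assms] T
    unfolding tree_name_def by blast
  then show "(if \<exists>g. infinite_path T g then 0 else 1) =
      1 - (if \<exists>f. coloring k H f \<and> proper H f then 1 else 0 :: nat)"
    by simp
qed

theorem theorem12:
  fixes k :: nat
  assumes "k \<ge> 2"
  shows "HPC k \<equiv>\<^sub>s\<^sub>W WF"
  unfolding sW_equivalent_def using HPC_reducible_WF[OF assms] WF_reducible_HPC[OF assms] ..

end
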